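(* Let $\alpha>0$, $n\in\mathbb N=\{1,2,\dots\}$, $0<a<b$, and let $x:[a,b]\to\mathbb R$ be a function of class $C^{n+1}$. Then for every $t\in\,]a,b[$, $$ {_a\mathcal{I}_t^\alpha} x(t)=\sum_{i=0}^{n}A_i(\alpha)\left(\ln\frac{t}{a}\right)^{\alpha+i} x_{i,0}(t)+\sum_{p=n+1}^\infty B(\alpha,p)\left(\ln\frac{t}{a}\right)^{\alpha+n-p}V_p(t), $$ (the series, including those defining $A_i(\alpha)$, being convergent), where $$ A_i(\alpha)=\frac{1}{\Gamma(\alpha+i+1)}\left[1+\sum_{p=n-i+1}^\infty\frac{\Gamma(p-\alpha-n)}{\Gamma(-\alpha-i)(p-n+i)!}\right],\quad B(\alpha,p)=\frac{\Gamma(p-\alpha-n)}{\Gamma(\alpha)\Gamma(1-\alpha)(p-n)!}, $$ $$ V_p(t)=\int_a^t (p-n)\left(\ln\frac{\tau}{a}\right)^{p-n-1}\frac{x(\tau)}{\tau}\,d\tau . $$ Moreover, let $N\ge n+1$ be an integer and consider the approximation $$ {_a\mathcal{I}_t^\alpha} x(t)\approx\sum_{i=0}^{n}A_i(\alpha,N)\left(\ln\frac{t}{a}\right)^{\alpha+i}x_{i,0}(t)+\sum_{p=n+1}^N B(\alpha,p)\left(\ln\frac{t}{a}\right)^{\alpha+n-p}V_p(t) $$ with $$ A_i(\alpha,N)=\frac{1}{\Gamma(\alpha+i+1)}\left[1+\sum_{p=n-i+1}^N\frac{\Gamma(p-\alpha-n)}{\Gamma(-\alpha-i)(p-n+i)!}\right].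 $$ Then the error $E_{tr}(t)$ (the left-hand side minus the right-hand side of the approximation) satisfies, for every $t\in\,]a,b[$, $$ \left| E_{tr}(t)\right|\leq L_n(t)\,\frac{e^{(\alpha+n)^2+\alpha+n}}{\Gamma(\alpha+n+1)(\alpha+n)N^{\alpha+n}} \left(\ln\frac{t}{a}\right)^{\alpha+n}(t-a),\qquad L_n(t)=\max_{\tau\in[a,t]}|x_{n,1}(\tau)|. $$
   Context: For $0<a<b$, $\alpha>0$ and integrable $x:[a,b]\to\mathbb R$, the left Hadamard fractional integral of order $\alpha$ is $$ {_a\mathcal{I}_t^\alpha} x(t)=\frac{1}{\Gamma(\alpha)}\int_a^t\left(\ln\frac{t}{\tau}\right)^{\alpha-1}\frac{x(\tau)}{\tau}\,d\tau,\quad t\in\,]a,b[. $$ The functions $x_{k,0}$ and $x_{k,1}$ are defined recursively for $k\ge 0$ by $x_{0,0}(t)=x(t)$, $x_{k+1,0}(t)=t\frac{d}{dt}x_{k,0}(t)$, and $x_{0,1}(t)=\dot x(t)$, $x_{k+1,1}(t)=\frac{d}{dt}\bigl(t\,x_{k,1}(t)\bigr)$. Convention on Gamma quotients (needed only when $\alpha$ is an integer, where the Gamma function has poles): $\frac{\Gamma(p-\alpha-n)}{\Gamma(-\alpha-i)}$ means $\prod_{j=0}^{p-n+i-1}(-\alpha-i+j)$, and $\frac{\Gamma(p-\alpha-n)}{\Gamma(1-\alpha)}$ means $\prod_{j=1}^{p-n-1}(j-\alpha)$ (an empty product being $1$); for non-integer $\alpha$ these are identities. *)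

theory Defs
  imports "HOL-Analysis.Analysis"
begin

text \<open>
  Functions on a closed interval are total functions of type \<^typ>\<open>real \<Rightarrow> real\<close> whose values outside
  the interval must not matter. Hence all derivatives are taken within the interval, i.e. they are
  one-sided at the end points.
\<close>

primrec Ck_on :: "nat \<Rightarrow> (real \<Rightarrow> real) \<Rightarrow> real set \<Rightarrow> bool" where
  "Ck_on 0 f S \<longleftrightarrow> continuous_on S f"
| "Ck_on (Suc k) f S \<longleftrightarrow>
     f differentiable_on S \<and> Ck_on k (\<lambda>t. vector_derivative f (at t within S)) S"

text \<open>\<open>hd0 S x k\<close> is $x_{k,0}$ and \<open>hd1 S x k\<close> is $x_{k,1}$, for \<open>S\<close> the domain of \<open>x\<close>.\<close>

primrec hd0 :: "real set \<Rightarrow> (real \<Rightarrow> real) \<Rightarrow> nat \<Rightarrow> real \<Rightarrow> real" where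
  "hd0 S x 0 = x"
| "hd0 S x (Suc k) = (\<lambda>t. t * vector_derivative (hd0 S x k) (at t within S))"

primrec hd1 :: "real set \<Rightarrow> (real \<Rightarrow> real) \<Rightarrow> nat \<Rightarrow> real \<Rightarrow> real" where
  "hd1 S x 0 = (\<lambda>t. vector_derivative x (at t within S))"
| "hd1 S x (Suc k) = (\<lambda>t. vector_derivative (\<lambda>s. s * hd1 S x k s) (at t within S))"

definition hadamard_integral :: "real \<Rightarrow> real \<Rightarrow> (real \<Rightarrow> real) \<Rightarrow> real \<Rightarrow> real" where
  "hadamard_integral a \<alpha> x t =
     1 / Gamma \<alpha> * (LBINT \<tau>=a..t. ln (t / \<tau>) powr (\<alpha> - 1) * (x \<tau> / \<tau>))"

text \<open>
  The quotient \<open>\<Gamma>(z + m) / \<Gamma>(z)\<close>, read as the product \<open>z (z + 1) \<dots> (z + m - 1)\<close>, also when \<open>z\<close> is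
  a pole of the Gamma function (where \<^const>\<open>Gamma\<close> has the value 0). It is used for
  \<open>\<Gamma>(p - \<alpha> - n) / \<Gamma>(-\<alpha> - i)\<close>, with \<open>z = -\<alpha> - i\<close> and \<open>m = p - n + i\<close>, and for
  \<open>\<Gamma>(p - \<alpha> - n) / \<Gamma>(1 - \<alpha>)\<close>, with \<open>z = 1 - \<alpha>\<close> and \<open>m = p - n - 1\<close>; the two lemmas below
  confirm the parameters.
\<close>

definition Gamma_quot :: "real \<Rightarrow> nat \<Rightarrow> real" where
  "Gamma_quot z m = (\<Prod>j<m. z + real j)"

lemma Gamma_quot_eq_Gamma:
  assumes "z \<notin> \<int>\<^sub>\<le>\<^sub>0"
  shows "Gamma_quot z m = Gamma (z + real m) / Gamma z"
  using pochhammer_Gamma[OF assms, of m]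
  by (simp add: Gamma_quot_def pochhammer_prod lessThan_atLeast0)

lemma Gamma_quot_A:
  assumes "\<alpha> \<notin> \<int>" "n \<le> p + i"
  shows "Gamma_quot (- \<alpha> - real i) (p + i - n)
           = Gamma (real p - \<alpha> - real n) / Gamma (- \<alpha> - real i)"
proof -
  have "- \<alpha> - real i \<notin> \<int>"
  proof
    assume "- \<alpha> - real i \<in> \<int>"
    then have "- (- \<alpha> - real i) - real i \<in> \<int>" by (intro Ints_diff Ints_minus) auto
    then show False using assms by simp
  qed
  then have "- \<alpha> - real i \<notin> \<int>\<^sub>\<le>\<^sub>0" using nonpos_Ints_subset_Ints by blast
  moreover have "- \<alpha> - real i + real (p + i - n) = real p - \<alpha> - real n"
    using assms(2) by (simp add: of_nat_diff)
  ultimately show ?thesis by (metis Gamma_quot_eq_Gamma)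
qed

lemma Gamma_quot_B:
  assumes "\<alpha> \<notin> \<int>" "n + 1 \<le> p"
  shows "Gamma_quot (1 - \<alpha>) (p - n - 1) = Gamma (real p - \<alpha> - real n) / Gamma (1 - \<alpha>)"
proof -
  have "1 - \<alpha> \<notin> \<int>"
  proof
    assume "1 - \<alpha> \<in> \<int>"
    then have "1 - (1 - \<alpha>) \<in> \<int>" by (intro Ints_diff) auto
    then show False using assms by simp
  qed
  then have "1 - \<alpha> \<notin> \<int>\<^sub>\<le>\<^sub>0" using nonpos_Ints_subset_Ints by blast
  moreover have "1 - \<alpha> + real (p - n - 1) = real p - \<alpha> - real n"
    using assms(2) by (simp add: of_nat_diff)
  ultimately show ?thesis by (metis Gamma_quot_eq_Gamma)
qed

text \<open>In the following, \<open>p\<close> is only used in the range \<open>p \<ge> n - i + 1\<close>, respectively \<open>p \<ge> n + 1\<close>.\<close>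

definition A_term :: "nat \<Rightarrow> real \<Rightarrow> nat \<Rightarrow> nat \<Rightarrow> real" where
  "A_term n \<alpha> i p = Gamma_quot (- \<alpha> - real i) (p + i - n) / fact (p + i - n)"

text \<open>The infinite sum over \<open>p \<ge> n - i + 1\<close> is written with \<open>p = n - i + 1 + k\<close>, where \<open>i \<le> n\<close>.\<close>

definition A_coeff :: "nat \<Rightarrow> real \<Rightarrow> nat \<Rightarrow> real" where
  "A_coeff n \<alpha> i = 1 / Gamma (\<alpha> + real i + 1) * (1 + (\<Sum>k. A_term n \<alpha> i (n - i + 1 + k)))"

definition A_coeff_trunc :: "nat \<Rightarrow> real \<Rightarrow> nat \<Rightarrow> nat \<Rightarrow> real" where
  "A_coeff_trunc n \<alpha> N i =
     1 / Gamma (\<alpha> + real i + 1) * (1 + (\<Sum>p = n - i + 1..N. A_term n \<alpha> i p))"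

definition B_coeff :: "nat \<Rightarrow> real \<Rightarrow> nat \<Rightarrow> real" where
  "B_coeff n \<alpha> p = Gamma_quot (1 - \<alpha>) (p - n - 1) / (Gamma \<alpha> * fact (p - n))"

definition V :: "nat \<Rightarrow> real \<Rightarrow> (real \<Rightarrow> real) \<Rightarrow> nat \<Rightarrow> real \<Rightarrow> real" where
  "V n a x p t = (LBINT \<tau>=a..t. real (p - n) * ln (\<tau> / a) ^ (p - n - 1) * (x \<tau> / \<tau>))"

definition BV_term :: "nat \<Rightarrow> real \<Rightarrow> real \<Rightarrow> (real \<Rightarrow> real) \<Rightarrow> real \<Rightarrow> nat \<Rightarrow> real" where
  "BV_term n \<alpha> a x t p =
     B_coeff n \<alpha> p * ln (t / a) powr (\<alpha> + real n - real p) * V n a x p t"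

definition hadamard_approx ::
    "nat \<Rightarrow> nat \<Rightarrow> real \<Rightarrow> real \<Rightarrow> real \<Rightarrow> (real \<Rightarrow> real) \<Rightarrow> real \<Rightarrow> real" where
  "hadamard_approx n N \<alpha> a b x t =
     (\<Sum>i = 0..n. A_coeff_trunc n \<alpha> N i * ln (t / a) powr (\<alpha> + real i) * hd0 {a..b} x i t)
     + (\<Sum>p = n + 1..N. BV_term n \<alpha> a x t p)"

definition truncation_error ::
    "nat \<Rightarrow> nat \<Rightarrow> real \<Rightarrow> real \<Rightarrow> real \<Rightarrow> (real \<Rightarrow> real) \<Rightarrow> real \<Rightarrow> real" where
  "truncation_error n N \<alpha> a b x t = hadamard_integral a \<alpha> x t - hadamard_approx n N \<alpha> a b x t"

text \<open>For \<open>x\<close> of class $C^{n+1}$ on \<open>{a..b}\<close> this supremum is over a continuous function on a compact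
  interval, hence a maximum.\<close>

definition L_max :: "nat \<Rightarrow> real \<Rightarrow> real \<Rightarrow> (real \<Rightarrow> real) \<Rightarrow> real \<Rightarrow> real" where
  "L_max n a b x t = (SUP \<tau>\<in>{a..t}. \<bar>hd1 {a..b} x n \<tau>\<bar>)"

end

theory Submission
  imports Defs
begin

text \<open>
  Let $K_{\gamma,M}(\tau)$ be $1/\Gamma(\gamma+1)$ times the remainder of degree $M$ of the binomial
  expansion of $(\ln\frac{t}{\tau})^\gamma = (\ln\frac{t}{a})^\gamma (1 - u)^\gamma$ in powers of
  $u = \ln\frac{\tau}{a} / \ln\frac{t}{a}$. It vanishes at $\tau = a$, and its derivative is
  $-K_{\gamma-1,M-1}(\tau)/\tau$. Integrating $\int_a^t K_{\alpha+n,N}\, x_{n,1}\, d\tau$ by parts $n+1$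
  times therefore produces the truncated coefficients $A_i(\alpha,N)$ as boundary terms at $\tau = t$ and
  ends with $\int_a^t K_{\alpha-1,N-n-1}\, x\, d\tau/\tau$, which is the Hadamard integral minus the
  truncated $V_p$ series. So the error is exactly $\int_a^t K_{\alpha+n,N}\, x_{n,1}\, d\tau$; it is
  bounded through $|{\beta \choose m}| \le e^{\beta^2+\beta}/m^{1+\beta}$, and letting $N \to \infty$
  gives the convergence of the $V_p$ series together with its value.
\<close>

subsection \<open>Binomial coefficients with real upper index\<close>

text \<open>The tangent estimate at $x = 2$, where equality holds, gives the constant $1/2$.\<close>

lemma abs_one_minus_le_exp:
  fixes x :: real
  assumes "x \<ge> 0"
  shows "\<bar>1 - x\<bar> \<le> exp (x\<^sup>2 / 2 - x)"
proof -
  have "1 - x \<le> exp (- x)" using exp_ge_add_one_self[of "- x"] by simp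
  also have "\<dots> \<le> exp (x\<^sup>2 / 2 - x)" by simp
  finally have 1: "1 - x \<le> exp (x\<^sup>2 / 2 - x)" .
  have "x - 1 \<le> exp (x - 2)" using exp_ge_add_one_self[of "x - 2"] by simp
  also have "\<dots> \<le> exp (x\<^sup>2 / 2 - x)"
    using zero_le_power2[of "x - 2"] by (simp add: power2_eq_square algebra_simps)
  finally show ?thesis using 1 by linarith
qed

text \<open>Telescoping through 1/(k+1)^2 \<le> 1/(k(k+1)). The step from k = 0 is treated apart,
  since 1/0 = 0 breaks this comparison there. The resulting bound 2 turns \<beta>^2/2 into the
  \<beta>^2 of the final exponent.\<close>

lemma sum_inverse_squares_le:
  "(\<Sum>j<k. 1 / (real (Suc j))\<^sup>2) \<le> 2 - 1 / real k"
proof (induction k)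
  case (Suc k)
  show ?case
  proof (cases "k = 0")
    case False
    have "1 / (real (Suc k))\<^sup>2 \<le> 1 / real k - 1 / real (Suc k)"
      using False by (simp add: divide_simps power2_eq_square)
    with Suc show ?thesis by simp
  qed simp
qed simp

text \<open>The quotient is the product of the factors 1 - \<beta>/j for j = 1..k.
  \<open>abs_one_minus_le_exp\<close> applied to each factor, whatever its sign, makes the exponents
  add up to a sum of inverse squares and a harmonic number.\<close>

lemma abs_pochhammer_over_fact_le:
  fixes \<beta> :: real
  assumes "\<beta> > 0"
  shows "\<bar>pochhammer (1 - \<beta>) k / fact k\<bar>
           \<le> exp (\<beta>\<^sup>2 / 2 * (\<Sum>j<k. 1 / (real (Suc j))\<^sup>2) - \<beta> * harm k)"
proof (induction k)
  case (Suc k)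
  define y where "y = \<beta> / real (Suc k)"
  have "pochhammer (1 - \<beta>) (Suc k) / fact (Suc k)
          = pochhammer (1 - \<beta>) k / fact k * (1 - y)"
    by (simp add: pochhammer_Suc y_def divide_simps)
  then have "\<bar>pochhammer (1 - \<beta>) (Suc k) / fact (Suc k)\<bar>
      = \<bar>pochhammer (1 - \<beta>) k / fact k\<bar> * \<bar>1 - y\<bar>"
    by (simp only: abs_mult)
  also have "\<dots> \<le> exp (\<beta>\<^sup>2 / 2 * (\<Sum>j<k. 1 / (real (Suc j))\<^sup>2) - \<beta> * harm k) * exp (y\<^sup>2 / 2 - y)"
    using assms by (intro mult_mono Suc.IH abs_one_minus_le_exp) (auto simp: y_def)
  also have "\<dots> = exp (\<beta>\<^sup>2 / 2 * (\<Sum>j<Suc k. 1 / (real (Suc j))\<^sup>2) - \<beta> * harm (Suc k))"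
    unfolding exp_add[symmetric]
    by (simp add: harm_Suc y_def power_divide distrib_left inverse_eq_divide)
  finally show ?case .
qed (simp add: harm_def)

text \<open>Up to sign this is the binomial coefficient of \<beta> over m. Splitting off the first
  factor leaves \<beta>/m times the product bounded above with k = m - 1; harm k \<ge> ln m supplies
  the decay, and \<beta> \<le> exp \<beta> accounts for the linear part of the exponent \<beta>^2 +
  \<beta>.\<close>

lemma abs_gen_binomial_coeff_le:
  fixes \<beta> :: real
  assumes "\<beta> > 0" "m \<ge> 1"
  shows "\<bar>pochhammer (- \<beta>) m / fact m\<bar> \<le> exp (\<beta>\<^sup>2 + \<beta>) / real m powr (1 + \<beta>)"
proof -
  obtain k where m: "m = Suc k" using assms(2) by (cases m) auto
  have "pochhammer (- \<beta>) m / fact m = - (\<beta> / real m) * (pochhammer (1 - \<beta>) k / fact k)"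
    unfolding m by (simp add: pochhammer_rec divide_simps)
  then have "\<bar>pochhammer (- \<beta>) m / fact m\<bar> = \<beta> / real m * \<bar>pochhammer (1 - \<beta>) k / fact k\<bar>"
    using assms(1) by (simp add: abs_mult)
  also have "\<dots> \<le> exp \<beta> / real m * exp (\<beta>\<^sup>2 - \<beta> * ln (real m))"
  proof (intro mult_mono divide_right_mono)
    show "\<beta> \<le> exp \<beta>" using exp_ge_add_one_self[of \<beta>] by linarith
    have "(\<Sum>j<k. 1 / (real (Suc j))\<^sup>2) \<le> 2"
      by (rule order_trans[OF sum_inverse_squares_le]) simp
    then have "\<beta>\<^sup>2 / 2 * (\<Sum>j<k. 1 / (real (Suc j))\<^sup>2) \<le> \<beta>\<^sup>2 / 2 * 2"
      by (intro mult_left_mono) auto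
    moreover have "\<beta> * ln (real m) \<le> \<beta> * harm k"
      using ln_le_harm[of k] assms(1) by (simp add: m add.commute)
    ultimately have "\<beta>\<^sup>2 / 2 * (\<Sum>j<k. 1 / (real (Suc j))\<^sup>2) - \<beta> * harm k \<le> \<beta>\<^sup>2 - \<beta> * ln (real m)"
      by simp
    with abs_pochhammer_over_fact_le[OF assms(1), of k]
    show "\<bar>pochhammer (1 - \<beta>) k / fact k\<bar> \<le> exp (\<beta>\<^sup>2 - \<beta> * ln (real m))"
      by (meson exp_le_cancel_iff order_trans)
  qed auto
  also have "\<dots> = exp (\<beta>\<^sup>2 + \<beta>) / real m powr (1 + \<beta>)"
    using m by (simp add: powr_def exp_add exp_diff distrib_right)
  finally show ?thesis .
qed

lemma summable_gen_binomial_coeff: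
  fixes \<beta> :: real
  assumes "\<beta> > 0"
  shows "summable (\<lambda>m. pochhammer (- \<beta>) m / fact m)"
proof (rule summable_comparison_test')
  show "summable (\<lambda>m. exp (\<beta>\<^sup>2 + \<beta>) * real m powr (- (1 + \<beta>)))"
    using assms by (intro summable_mult) (simp add: summable_real_powr_iff)
  show "norm (pochhammer (- \<beta>) m / fact m) \<le> exp (\<beta>\<^sup>2 + \<beta>) * real m powr (- (1 + \<beta>))" if "m \<ge> 1" for m
    using abs_gen_binomial_coeff_le[OF assms that]
    by (simp only: real_norm_def powr_minus divide_inverse)
qed

section \<open>Tail of the binomial series\<close>

text \<open>A discrete form of comparing the sum with the integral of \<beta> s^(-1-\<beta>). With y
  = 1/(m+1), the chain 1 + \<beta> y \<le> exp(\<beta> y) \<le> (1-y)^(-\<beta>) is divided by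
  (m+1)^\<beta>.\<close>

lemma powr_le_telescope:
  fixes \<beta> :: real
  assumes "\<beta> > 0" "m \<ge> 1"
  shows "\<beta> / real (Suc m) powr (1 + \<beta>) \<le> 1 / real m powr \<beta> - 1 / real (Suc m) powr \<beta>"
proof -
  define y where "y = 1 / real (Suc m)"
  have y: "0 < y" "y < 1" using assms(2) by (auto simp: y_def)
  have "1 + \<beta> * y \<le> exp (\<beta> * y)" by simp
  also have "\<dots> \<le> exp (- \<beta> * ln (1 - y))"
    using mult_left_mono[OF ln_add_one_self_le_self2[of "- y"], of \<beta>] y assms(1) by simp
  also have "\<dots> = (real m / real (Suc m)) powr (- \<beta>)"
  proof -
    have "1 - y = real m / real (Suc m)" by (simp add: y_def field_simps)
    moreover have "real m / real (Suc m) > 0" using assms(2) by simp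
    ultimately show ?thesis using assms(2) by (simp add: powr_def)
  qed
  also have "\<dots> = real (Suc m) powr \<beta> / real m powr \<beta>"
    by (simp add: powr_divide powr_minus_divide)
  finally have *: "1 + \<beta> / real (Suc m) \<le> real (Suc m) powr \<beta> / real m powr \<beta>"
    by (simp add: y_def)
  have p: "real (Suc m) powr \<beta> > 0" "real m powr \<beta> > 0" using assms(2) by auto
  have e: "real (Suc m) powr (1 + \<beta>) = real (Suc m) * real (Suc m) powr \<beta>"
    by (simp add: powr_add)
  from divide_right_mono[OF *, of "real (Suc m) powr \<beta>"] p
  show ?thesis unfolding e by (simp add: add_divide_distrib)
qed

text \<open>The bound does not depend on k, so it survives the passage from finite sections to the
  whole tail.\<close>

lemma sum_powr_tail_le:
  fixes \<beta> :: real
  assumes "\<beta> > 0" "N \<ge> 1"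
  shows "(\<Sum>m = Suc N..N + k. 1 / real m powr (1 + \<beta>)) \<le> 1 / (\<beta> * real N powr \<beta>)"
proof -
  have "(\<Sum>m = Suc N..N + k. \<beta> / real m powr (1 + \<beta>)) \<le> 1 / real N powr \<beta> - 1 / real (N + k) powr \<beta>"
  proof (induction k)
    case (Suc k)
    have "\<beta> / real (Suc (N + k)) powr (1 + \<beta>)
        \<le> 1 / real (N + k) powr \<beta> - 1 / real (Suc (N + k)) powr \<beta>"
      using assms by (intro powr_le_telescope) auto
    with Suc show ?case by simp
  qed simp
  also have "\<dots> \<le> 1 / real N powr \<beta>" by simp
  finally have "\<beta> * (\<Sum>m = Suc N..N + k. 1 / real m powr (1 + \<beta>)) \<le> 1 / real N powr \<beta>"
    by (simp add: sum_distrib_left)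
  then have "(\<Sum>m = Suc N..N + k. 1 / real m powr (1 + \<beta>)) \<le> 1 / real N powr \<beta> / \<beta>"
    using assms(1) by (simp only: pos_le_divide_eq mult.commute)
  then show ?thesis by (simp add: mult.commute)
qed

text \<open>For y < 1 the power equals its binomial series, so the difference is the tail after
  degree N. Bounding each y^m by 1 leaves the tail of the coefficients, which makes the estimate
  uniform in y.\<close>

lemma gen_binomial_remainder_le:
  fixes \<beta> y :: real
  assumes "\<beta> > 0" "N \<ge> 1" "0 \<le> y" "y < 1"
  shows "\<bar>(1 - y) powr \<beta> - (\<Sum>m\<le>N. pochhammer (- \<beta>) m / fact m * y ^ m)\<bar>
           \<le> exp (\<beta>\<^sup>2 + \<beta>) / (\<beta> * real N powr \<beta>)"
proof -
  define c where "c m = pochhammer (- \<beta>) m / fact m * y ^ m" for m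
  have "(\<lambda>m. (\<beta> gchoose m) * (- y) ^ m) sums (1 + (- y)) powr \<beta>"
    using assms by (intro gen_binomial_real) auto
  \<comment> \<open>The sign (-1)^m from writing the binomial coefficient through
    \<open>pochhammer\<close> cancels the one in (-y)^m.\<close>
  moreover have "(\<beta> gchoose m) * (- y) ^ m = c m" for m
  proof -
    have "(- y) ^ m = (- 1) ^ m * y ^ m" by (rule power_minus)
    then show ?thesis
      by (simp add: c_def gbinomial_pochhammer)
  qed
  ultimately have "c sums (1 - y) powr \<beta>" by simp
  then have "(\<lambda>k. sum c {..k}) \<longlonglongrightarrow> (1 - y) powr \<beta>" by (simp add: sums_def_le)
  then have "(\<lambda>k. sum c {..N + k}) \<longlonglongrightarrow> (1 - y) powr \<beta>"
    using LIMSEQ_ignore_initial_segment[of _ _ N] by (simp add: add.commute)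
  then have lim: "(\<lambda>k. \<bar>sum c {..N + k} - sum c {..N}\<bar>) \<longlonglongrightarrow> \<bar>(1 - y) powr \<beta> - sum c {..N}\<bar>"
    by (intro tendsto_intros)
  have "\<bar>sum c {..N + k} - sum c {..N}\<bar> \<le> exp (\<beta>\<^sup>2 + \<beta>) / (\<beta> * real N powr \<beta>)" for k
  proof -
    have "{..N + k} = {..N} \<union> {Suc N..N + k}" by auto
    then have "sum c {..N + k} = sum c {..N} + sum c {Suc N..N + k}"
      by (simp add: sum.union_disjoint ivl_disj_int)
    then have "\<bar>sum c {..N + k} - sum c {..N}\<bar> \<le> (\<Sum>m = Suc N..N + k. \<bar>c m\<bar>)" by simp
    also have "\<dots> \<le> (\<Sum>m = Suc N..N + k. exp (\<beta>\<^sup>2 + \<beta>) * (1 / real m powr (1 + \<beta>)))"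
    proof (rule sum_mono)
      fix m assume m: "m \<in> {Suc N..N + k}"
      have "\<bar>c m\<bar> \<le> \<bar>pochhammer (- \<beta>) m / fact m\<bar> * 1"
        unfolding c_def abs_mult using assms by (intro mult_left_mono) (auto simp: power_le_one)
      with abs_gen_binomial_coeff_le[OF assms(1), of m] m
      show "\<bar>c m\<bar> \<le> exp (\<beta>\<^sup>2 + \<beta>) * (1 / real m powr (1 + \<beta>))" by simp
    qed
    also have "\<dots> = exp (\<beta>\<^sup>2 + \<beta>) * (\<Sum>m = Suc N..N + k. 1 / real m powr (1 + \<beta>))"
      by (simp add: sum_distrib_left)
    also have "\<dots> \<le> exp (\<beta>\<^sup>2 + \<beta>) * (1 / (\<beta> * real N powr \<beta>))"
      using assms by (intro mult_left_mono sum_powr_tail_le) auto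
    finally show ?thesis by simp
  qed
  then have "\<bar>(1 - y) powr \<beta> - sum c {..N}\<bar> \<le> exp (\<beta>\<^sup>2 + \<beta>) / (\<beta> * real N powr \<beta>)"
    by (intro LIMSEQ_le_const2[OF lim]) auto
  then show ?thesis unfolding c_def[abs_def] .
qed

subsection \<open>The remainder kernel\<close>

text \<open>Keeping ln(t/a)^(\<gamma>-m) and ln(\<tau>/a)^m apart matches the terms of the V_p
  series and makes differentiation in \<tau> direct. The factor 1/Gamma(\<gamma>+1) absorbs the
  \<gamma> that each differentiation produces.\<close>

definition hadamard_kernel :: "real \<Rightarrow> real \<Rightarrow> real \<Rightarrow> nat \<Rightarrow> real \<Rightarrow> real" where
  "hadamard_kernel a t \<gamma> M \<tau> =
     (ln (t / \<tau>) powr \<gamma>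
      - (\<Sum>m\<le>M. pochhammer (- \<gamma>) m / fact m * ln (t / a) powr (\<gamma> - real m) * ln (\<tau> / a) ^ m))
     / Gamma (\<gamma> + 1)"

text \<open>Only m = 0 survives at \<tau> = a, where it cancels the power. This removes the lower
  boundary term in every integration by parts.\<close>

lemma hadamard_kernel_left:
  assumes "a > 0"
  shows "hadamard_kernel a t \<gamma> M a = 0"
proof -
  have "(\<Sum>m\<le>M. pochhammer (- \<gamma>) m / fact m * ln (t / a) powr (\<gamma> - real m) * ln (a / a) ^ m)
      = (\<Sum>m\<le>M. if m = 0 then ln (t / a) powr \<gamma> else 0)"
    using assms by (intro sum.cong) (auto simp: power_0_left)
  then show ?thesis by (simp add: hadamard_kernel_def)
qed

text \<open>Here u = 1, so a bare partial sum of binomial coefficients remains: the source of the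
  coefficients \<open>A_coeff_trunc\<close>.\<close>

lemma hadamard_kernel_right:
  assumes "0 < a" "a < t"
  shows "hadamard_kernel a t \<gamma> M t =
    - (ln (t / a) powr \<gamma> * (\<Sum>m\<le>M. pochhammer (- \<gamma>) m / fact m) / Gamma (\<gamma> + 1))"
proof -
  have s: "ln (t / a) > 0" using assms by (simp add: ln_gt_zero)
  have "ln (t / a) powr (\<gamma> - real m) * ln (t / a) ^ m = ln (t / a) powr \<gamma>" for m
    using s by (simp add: powr_diff powr_realpow)
  then have "(\<Sum>m\<le>M. pochhammer (- \<gamma>) m / fact m * ln (t / a) powr (\<gamma> - real m) * ln (t / a) ^ m)
      = ln (t / a) powr \<gamma> * (\<Sum>m\<le>M. pochhammer (- \<gamma>) m / fact m)"
    by (simp add: sum_distrib_left mult.assoc mult.left_commute mult.commute)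
  then show ?thesis using assms by (simp only: hadamard_kernel_def) simp
qed

lemma hadamard_kernel_continuous:
  assumes "0 < a" "a < t" "\<gamma> > 0"
  shows "continuous_on {a..t} (hadamard_kernel a t \<gamma> M)"
proof -
  have c: "continuous_on {a..t} (\<lambda>\<tau>. ln (t / \<tau>))" "continuous_on {a..t} (\<lambda>\<tau>. ln (\<tau> / a))"
    using assms by (auto intro!: continuous_intros)
  have "Gamma (\<gamma> + 1) \<noteq> 0" using Gamma_real_pos[of "\<gamma> + 1"] assms by linarith
  moreover have "0 \<le> ln (t / \<tau>)" if "\<tau> \<in> {a..t}" for \<tau>
    using that assms by auto
  ultimately show ?thesis
    unfolding hadamard_kernel_def[abs_def] using assms
    by (intro continuous_on_divide continuous_on_diff continuous_on_sum continuous_on_mult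
        continuous_on_const continuous_on_power continuous_on_powr' c) auto
qed

text \<open>Both the power and its expansion lower \<gamma> by one under differentiation, with the
  common factor \<gamma> cancelled by Gamma(\<gamma>+1) = \<gamma> Gamma(\<gamma>). The endpoint t
  is excluded because ln(t/\<tau>)^(\<gamma>-1) blows up there for \<gamma> < 1.\<close>

lemma hadamard_kernel_has_derivative:
  assumes "0 < a" "a < \<tau>" "\<tau> < t" "\<gamma> > 0"
  shows "(hadamard_kernel a t \<gamma> (Suc M) has_real_derivative
           - (hadamard_kernel a t (\<gamma> - 1) M \<tau> / \<tau>)) (at \<tau>)"
proof -
  define s where "s = ln (t / a)"
  define c where "c m = pochhammer (- \<gamma>) m / fact m" for m
  have lt: "ln (t / \<tau>) > 0" using assms by (simp add: ln_gt_zero)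
  have G: "Gamma (\<gamma> + 1) = \<gamma> * Gamma \<gamma>" "Gamma \<gamma> > 0"
    using assms by (auto intro!: Gamma_plus1 simp: nonpos_Ints_def)
  have 1: "((\<lambda>\<tau>. ln (t / \<tau>) powr \<gamma>) has_real_derivative - (\<gamma> * ln (t / \<tau>) powr (\<gamma> - 1) / \<tau>)) (at \<tau>)"
    using assms lt
    by (auto intro!: derivative_eq_intros simp: field_simps powr_diff)
  have d: "((\<lambda>\<tau>. ln (\<tau> / a) ^ Suc m) has_real_derivative real (Suc m) * ln (\<tau> / a) ^ m / \<tau>) (at \<tau>)" for m
  proof -
    have "((\<lambda>\<tau>. ln (\<tau> / a)) has_real_derivative 1 / \<tau>) (at \<tau>)"
      using assms by (auto intro!: derivative_eq_intros)
    from DERIV_power_Suc[OF this, of m] show ?thesis by (simp add: algebra_simps)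
  qed
  \<comment> \<open>The absorption identity for binomial coefficients, with the alternating signs
    included.\<close>
  have c: "c (Suc m) * real (Suc m) = - \<gamma> * (pochhammer (- (\<gamma> - 1)) m / fact m)" for m
  proof -
    have "- \<gamma> + 1 = - (\<gamma> - 1)" by simp
    then show ?thesis by (simp add: c_def pochhammer_rec divide_simps)
  qed
  \<comment> \<open>The term m = 0 is constant in \<tau>; its loss is why the degree drops by
    one.\<close>
  have "((\<lambda>\<tau>. c 0 * s powr (\<gamma> - real 0) + (\<Sum>m\<le>M. c (Suc m) * s powr (\<gamma> - real (Suc m)) * ln (\<tau> / a) ^ Suc m))
      has_real_derivative
      (0 + (\<Sum>m\<le>M. c (Suc m) * s powr (\<gamma> - real (Suc m)) * (real (Suc m) * ln (\<tau> / a) ^ m / \<tau>)))) (at \<tau>)"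
    by (intro DERIV_add DERIV_const DERIV_sum DERIV_cmult d)
  also have "(\<lambda>\<tau>. c 0 * s powr (\<gamma> - real 0) + (\<Sum>m\<le>M. c (Suc m) * s powr (\<gamma> - real (Suc m)) * ln (\<tau> / a) ^ Suc m))
      = (\<lambda>\<tau>. \<Sum>m\<le>Suc M. c m * s powr (\<gamma> - real m) * ln (\<tau> / a) ^ m)"
    by (subst sum.atMost_Suc_shift) simp
  also have "0 + (\<Sum>m\<le>M. c (Suc m) * s powr (\<gamma> - real (Suc m)) * (real (Suc m) * ln (\<tau> / a) ^ m / \<tau>))
     = - (\<gamma> * (\<Sum>m\<le>M. pochhammer (- (\<gamma> - 1)) m / fact m * s powr (\<gamma> - 1 - real m) * ln (\<tau> / a) ^ m) / \<tau>)"
    unfolding sum_distrib_left sum_divide_distrib sum_negf[symmetric] add_0_left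
  proof (rule sum.cong)
    fix m
    have "c (Suc m) * s powr (\<gamma> - real (Suc m)) * (real (Suc m) * ln (\<tau> / a) ^ m / \<tau>)
       = (c (Suc m) * real (Suc m)) * s powr (\<gamma> - 1 - real m) * ln (\<tau> / a) ^ m / \<tau>"
      by (simp add: algebra_simps)
    also have "\<dots> = - (\<gamma> * (pochhammer (- (\<gamma> - 1)) m / fact m * s powr (\<gamma> - 1 - real m) * ln (\<tau> / a) ^ m) / \<tau>)"
      unfolding c by simp
    finally show "c (Suc m) * s powr (\<gamma> - real (Suc m)) * (real (Suc m) * ln (\<tau> / a) ^ m / \<tau>) = \<dots>" .
  qed simp
  finally have 2: "((\<lambda>\<tau>. \<Sum>m\<le>Suc M. c m * s powr (\<gamma> - real m) * ln (\<tau> / a) ^ m) has_real_derivative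
     - (\<gamma> * (\<Sum>m\<le>M. pochhammer (- (\<gamma> - 1)) m / fact m * s powr (\<gamma> - 1 - real m) * ln (\<tau> / a) ^ m) / \<tau>)) (at \<tau>)" .
  have "(hadamard_kernel a t \<gamma> (Suc M) has_real_derivative
     (- (\<gamma> * ln (t / \<tau>) powr (\<gamma> - 1) / \<tau>) -
      - (\<gamma> * (\<Sum>m\<le>M. pochhammer (- (\<gamma> - 1)) m / fact m * s powr (\<gamma> - 1 - real m) * ln (\<tau> / a) ^ m) / \<tau>))
      / Gamma (\<gamma> + 1)) (at \<tau>)"
    unfolding hadamard_kernel_def[abs_def] s_def[symmetric] c_def[symmetric]
    by (intro DERIV_cdivide DERIV_diff 1 2)
  also have "(- (\<gamma> * ln (t / \<tau>) powr (\<gamma> - 1) / \<tau>) -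
      - (\<gamma> * (\<Sum>m\<le>M. pochhammer (- (\<gamma> - 1)) m / fact m * s powr (\<gamma> - 1 - real m) * ln (\<tau> / a) ^ m) / \<tau>))
      / Gamma (\<gamma> + 1) = - (hadamard_kernel a t (\<gamma> - 1) M \<tau> / \<tau>)"
    unfolding hadamard_kernel_def s_def[symmetric] G(1) using assms G(2)
    by (simp add: divide_simps) (simp add: algebra_simps)
  finally show ?thesis .
qed

text \<open>With s = ln(t/a) and y = ln(\<tau>/a)/s, a factor s^\<beta> splits off and the binomial
  remainder at y is left. The condition \<tau> < t is y < 1.\<close>

lemma abs_hadamard_kernel_le:
  assumes "0 < a" "a \<le> \<tau>" "\<tau> < t" "\<beta> > 0" "N \<ge> 1"
  shows "\<bar>hadamard_kernel a t \<beta> N \<tau>\<bar> \<le>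
    exp (\<beta>\<^sup>2 + \<beta>) / (Gamma (\<beta> + 1) * \<beta> * real N powr \<beta>) * ln (t / a) powr \<beta>"
proof -
  define s where "s = ln (t / a)"
  define y where "y = ln (\<tau> / a) / s"
  have s: "s > 0" using assms by (simp add: s_def ln_gt_zero)
  have G: "Gamma (\<beta> + 1) > 0" using assms by simp
  have lt: "ln (t / \<tau>) = s * (1 - y)" and u: "ln (\<tau> / a) = s * y"
    using assms s unfolding y_def by (auto simp: s_def ln_div field_simps)
  have "ln (\<tau> / a) \<ge> 0" "ln (t / \<tau>) > 0" using assms by (auto simp: ln_gt_zero ln_ge_zero)
  then have y: "0 \<le> y" "y < 1" using s unfolding lt u by (auto simp: zero_le_mult_iff zero_less_mult_iff)
  have "s powr (\<beta> - real m) * (s * y) ^ m = s powr \<beta> * y ^ m" for m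
    using s by (simp add: powr_diff powr_realpow power_mult_distrib)
  then have 1: "(\<Sum>m\<le>N. pochhammer (- \<beta>) m / fact m * s powr (\<beta> - real m) * (s * y) ^ m)
     = s powr \<beta> * (\<Sum>m\<le>N. pochhammer (- \<beta>) m / fact m * y ^ m)"
    by (simp add: sum_distrib_left mult.assoc mult.left_commute)
  have 2: "(s * (1 - y)) powr \<beta> = s powr \<beta> * (1 - y) powr \<beta>"
    by (rule powr_mult)
  have "hadamard_kernel a t \<beta> N \<tau>
     = s powr \<beta> * ((1 - y) powr \<beta> - (\<Sum>m\<le>N. pochhammer (- \<beta>) m / fact m * y ^ m)) / Gamma (\<beta> + 1)"
    unfolding hadamard_kernel_def s_def[symmetric] lt u 1 2 by (simp only: right_diff_distrib)
  then have "\<bar>hadamard_kernel a t \<beta> N \<tau>\<bar>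
     = s powr \<beta> * \<bar>(1 - y) powr \<beta> - (\<Sum>m\<le>N. pochhammer (- \<beta>) m / fact m * y ^ m)\<bar> / Gamma (\<beta> + 1)"
    using G by (simp add: abs_mult)
  also have "\<dots> \<le> s powr \<beta> * (exp (\<beta>\<^sup>2 + \<beta>) / (\<beta> * real N powr \<beta>)) / Gamma (\<beta> + 1)"
    using G assms y by (intro divide_right_mono mult_left_mono gen_binomial_remainder_le) auto
  finally show ?thesis by (simp add: s_def mult_ac)
qed

section \<open>Integration by parts against the kernel\<close>

text \<open>The product rule is needed only in the open interval, because the fundamental theorem is
  used in its version for continuous functions differentiable in the interior. Integrability of the
  new integrand, which can be unbounded near t when \<gamma> < 1, is part of the conclusion.\<close>

lemma hadamard_kernel_by_parts:
  assumes "0 < a" "a < t" "\<gamma> > 0"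
    and f: "\<And>\<tau>. \<tau> \<in> {a..t} \<Longrightarrow> (f has_real_derivative f' \<tau>) (at \<tau> within {a..t})"
    and I: "((\<lambda>\<tau>. hadamard_kernel a t \<gamma> (Suc M) \<tau> * f' \<tau>) has_integral E) {a..t}"
  shows "((\<lambda>\<tau>. hadamard_kernel a t (\<gamma> - 1) M \<tau> * (f \<tau> / \<tau>)) has_integral
           (E - hadamard_kernel a t \<gamma> (Suc M) t * f t)) {a..t}"
proof -
  let ?K = "hadamard_kernel a t \<gamma> (Suc M)"
  have "continuous_on {a..t} f"
    by (rule DERIV_continuous_on[OF f])
  then have cont: "continuous_on {a..t} (\<lambda>\<tau>. ?K \<tau> * f \<tau>)"
    using assms by (intro continuous_on_mult hadamard_kernel_continuous)
  have "((\<lambda>\<tau>. ?K \<tau> * f \<tau>) has_vector_derivative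
      (?K \<tau> * f' \<tau> - hadamard_kernel a t (\<gamma> - 1) M \<tau> * (f \<tau> / \<tau>))) (at \<tau>)"
    if \<tau>: "\<tau> \<in> {a<..<t}" for \<tau>
  proof -
    have "(f has_real_derivative f' \<tau>) (at \<tau>)"
      using f[of \<tau>] \<tau> by (simp add: at_within_Icc_at)
    then have "((\<lambda>\<tau>. ?K \<tau> * f \<tau>) has_real_derivative
      (- (hadamard_kernel a t (\<gamma> - 1) M \<tau> / \<tau>) * f \<tau> + f' \<tau> * ?K \<tau>)) (at \<tau>)"
      using \<tau> assms by (intro DERIV_mult hadamard_kernel_has_derivative) auto
    then show ?thesis
      by (simp add: has_real_derivative_iff_has_vector_derivative algebra_simps)
  qed
  from fundamental_theorem_of_calculus_interior[OF _ cont this] assms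
  have "((\<lambda>\<tau>. ?K \<tau> * f' \<tau> - hadamard_kernel a t (\<gamma> - 1) M \<tau> * (f \<tau> / \<tau>))
     has_integral ?K t * f t) {a..t}"
    by (simp add: hadamard_kernel_left)
  from has_integral_diff[OF I this] show ?thesis by simp
qed

text \<open>In the application \<open>y i\<close> is x_{i,0} and \<open>d i\<close> is x_{i,1}. The
  steps run from i = n down to 0, each lowering both the exponent and the degree; E is arbitrary in
  the induction because it collects the boundary terms.\<close>

lemma hadamard_kernel_iterated_by_parts:
  assumes "0 < a" "a < t" "\<alpha> > 0"
    and "\<And>i \<tau>. i \<le> n \<Longrightarrow> \<tau> \<in> {a..t} \<Longrightarrow> (y i has_real_derivative d i \<tau>) (at \<tau> within {a..t})"
    and "\<And>i \<tau>. i < n \<Longrightarrow> \<tau> \<in> {a..t} \<Longrightarrow> y (Suc i) \<tau> = \<tau> * d i \<tau>"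
    and "((\<lambda>\<tau>. hadamard_kernel a t (\<alpha> + real n) (Suc (M + n)) \<tau> * d n \<tau>) has_integral E) {a..t}"
  shows "((\<lambda>\<tau>. hadamard_kernel a t (\<alpha> - 1) M \<tau> * (y 0 \<tau> / \<tau>)) has_integral
           (E - (\<Sum>i\<le>n. hadamard_kernel a t (\<alpha> + real i) (Suc (M + i)) t * y i t))) {a..t}"
  using assms
proof (induction n arbitrary: E)
  case 0
  then show ?case
    using hadamard_kernel_by_parts[of a t \<alpha> "y 0" "d 0" M E] by simp
next
  case (Suc n)
  let ?B = "hadamard_kernel a t (\<alpha> + real (Suc n)) (Suc (M + Suc n)) t * y (Suc n) t"
  have "((\<lambda>\<tau>. hadamard_kernel a t (\<alpha> + real (Suc n) - 1) (M + Suc n) \<tau> * (y (Suc n) \<tau> / \<tau>))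
     has_integral (E - ?B)) {a..t}"
    using Suc.prems by (intro hadamard_kernel_by_parts[where f' = "d (Suc n)"]) auto
  \<comment> \<open>Since \<open>y (Suc n)\<close> is \<tau> times \<open>d n\<close>, the division
    by \<tau> left by the previous step restores the form required by the induction
    hypothesis.\<close>
  then have "((\<lambda>\<tau>. hadamard_kernel a t (\<alpha> + real n) (Suc (M + n)) \<tau> * d n \<tau>) has_integral (E - ?B)) {a..t}"
    by (rule has_integral_eq[rotated]) (use Suc.prems in auto)
  from Suc.IH[OF Suc.prems(1-3) _ _ this] Suc.prems(4,5)
  show ?case by (simp add: algebra_simps)
qed

subsection \<open>The coefficients\<close>

lemma Gamma_quot_eq_pochhammer: "Gamma_quot z m = pochhammer z m"
  by (simp add: Gamma_quot_def pochhammer_prod lessThan_atLeast0)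

text \<open>The shift turns p - n + i into k + 1, so the terms are the binomial coefficients of
  \<alpha> + i up to sign, from index 1 on. The separate summand 1 in A_i is the one of index
  0.\<close>

lemma A_term_eq:
  assumes "i \<le> n"
  shows "A_term n \<alpha> i (n - i + 1 + k) = pochhammer (- (\<alpha> + real i)) (Suc k) / fact (Suc k)"
proof -
  have "n - i + 1 + k + i - n = Suc k" "- \<alpha> - real i = - (\<alpha> + real i)"
    using assms by auto
  then show ?thesis by (simp only: A_term_def Gamma_quot_eq_pochhammer)
qed

text \<open>With N = M + n + 1 the last index is N - n + i = M + i + 1, exactly the degree of the
  kernel in the i-th boundary term.\<close>

lemma A_coeff_trunc_eq:
  assumes "i \<le> n"
  shows "A_coeff_trunc n \<alpha> (Suc (M + n)) i =
    (\<Sum>m\<le>Suc (M + i). pochhammer (- (\<alpha> + real i)) m / fact m) / Gamma (\<alpha> + real i + 1)"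
proof -
  have "(\<Sum>p = n - i + 1..Suc (M + n). A_term n \<alpha> i p)
      = (\<Sum>p = 0 + (n - i + 1)..(M + i) + (n - i + 1). A_term n \<alpha> i p)"
    using assms by (intro sum.cong) auto
  also have "\<dots> = (\<Sum>k\<le>M + i. A_term n \<alpha> i (n - i + 1 + k))"
    by (subst sum.shift_bounds_cl_nat_ivl) (simp add: atLeast0AtMost add.commute)
  also have "1 + \<dots> = (\<Sum>m\<le>Suc (M + i). pochhammer (- (\<alpha> + real i)) m / fact m)"
    by (subst sum.atMost_Suc_shift) (simp only: A_term_eq[OF assms] pochhammer_0 fact_0 div_by_1)
  finally show ?thesis by (simp add: A_coeff_trunc_def)
qed

lemma summable_A_term:
  assumes "\<alpha> > 0" "i \<le> n"
  shows "summable (\<lambda>k. A_term n \<alpha> i (n - i + 1 + k))"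
  unfolding A_term_eq[OF assms(2)]
  using summable_gen_binomial_coeff[of "\<alpha> + real i"] assms(1) by (subst summable_Suc_iff) auto

lemma A_coeff_trunc_tendsto:
  assumes "\<alpha> > 0" "i \<le> n"
  shows "(\<lambda>M. A_coeff_trunc n \<alpha> (Suc (M + n)) i) \<longlonglongrightarrow> A_coeff n \<alpha> i"
proof -
  let ?c = "\<lambda>m. pochhammer (- (\<alpha> + real i)) m / fact m"
  have s: "summable ?c"
    using assms(1) by (intro summable_gen_binomial_coeff) auto
  have "(\<lambda>M. \<Sum>m\<le>M. ?c m) \<longlonglongrightarrow> (\<Sum>m. ?c m)"
    using summable_sums[OF s] by (simp add: sums_def_le)
  from LIMSEQ_ignore_initial_segment[OF this, of "Suc i"]
  have "(\<lambda>M. (\<Sum>m\<le>Suc (M + i). ?c m) / Gamma (\<alpha> + real i + 1))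
      \<longlonglongrightarrow> (\<Sum>m. ?c m) / Gamma (\<alpha> + real i + 1)"
    unfolding add_Suc_right divide_inverse by (rule tendsto_mult_right)
  moreover have "A_coeff n \<alpha> i = (\<Sum>m. ?c m) / Gamma (\<alpha> + real i + 1)"
    unfolding A_coeff_def A_term_eq[OF assms(2)] using suminf_split_head[OF s] by simp
  ultimately show ?thesis by (simp only: A_coeff_trunc_eq[OF assms(2)])
qed

subsection \<open>Functions of class $C^k$\<close>

text \<open>Needed because rules such as the sum rule identify derivatives only at points of the
  interval, while \<open>Ck_on\<close> takes total functions.\<close>

lemma Ck_on_cong:
  assumes "\<And>t. t \<in> S \<Longrightarrow> f t = g t" "Ck_on k f S"
  shows "Ck_on k g S"
  using assms
proof (induction k arbitrary: f g)
  case 0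
  then show ?case using continuous_on_cong by fastforce
next
  case (Suc k)
  have fg: "(f has_vector_derivative D) (at t within S) \<longleftrightarrow> (g has_vector_derivative D) (at t within S)"
    if "t \<in> S" for t D
    using has_vector_derivative_transform[of t S f g D] has_vector_derivative_transform[of t S g f D]
      Suc.prems(1) that by auto
  then have "vector_derivative f (at t within S) = vector_derivative g (at t within S)" if "t \<in> S" for t
    using that by (simp add: vector_derivative_def)
  moreover have "g differentiable_on S"
    unfolding differentiable_on_def
  proof
    fix t assume t: "t \<in> S"
    then have "(f has_vector_derivative vector_derivative f (at t within S)) (at t within S)"
      using Suc.prems(2) vector_derivative_works by (auto simp: differentiable_on_def)
    then show "g differentiable (at t within S)"
      using fg[OF t] differentiableI_vector by blast
  qed
  moreover have "Ck_on k (\<lambda>t. vector_derivative f (at t within S)) S"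
    using Suc.prems(2) by simp
  ultimately show ?case
    using Suc.IH[of "\<lambda>t. vector_derivative f (at t within S)" "\<lambda>t. vector_derivative g (at t within S)"]
    by simp
qed

lemma Ck_on_Suc_imp: "Ck_on (Suc k) f S \<Longrightarrow> Ck_on k f S"
  by (induction k arbitrary: f) (auto intro: differentiable_imp_continuous_on)

lemma Ck_on_has_vector_derivative:
  assumes "Ck_on (Suc k) f S" "t \<in> S"
  shows "(f has_vector_derivative vector_derivative f (at t within S)) (at t within S)"
  using assms vector_derivative_works by (auto simp: differentiable_on_def)

lemma Ck_on_add:
  fixes a b :: real
  assumes "a < b" "Ck_on k f {a..b}" "Ck_on k g {a..b}"
  shows "Ck_on k (\<lambda>t. f t + g t) {a..b}"
  using assms(2,3)
proof (induction k arbitrary: f g)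
  case 0
  then show ?case by (simp add: continuous_on_add)
next
  case (Suc k)
  have "vector_derivative f (at t within {a..b}) + vector_derivative g (at t within {a..b})
     = vector_derivative (\<lambda>t. f t + g t) (at t within {a..b})" if "t \<in> {a..b}" for t
    using assms(1) that Ck_on_has_vector_derivative Suc.prems
    by (intro vector_derivative_within_closed_interval[symmetric] has_vector_derivative_add) auto
  moreover have "Ck_on k (\<lambda>t. vector_derivative f (at t within {a..b})
     + vector_derivative g (at t within {a..b})) {a..b}"
    using Suc.prems by (intro Suc.IH) auto
  ultimately have "Ck_on k (\<lambda>t. vector_derivative (\<lambda>t. f t + g t) (at t within {a..b})) {a..b}"
    by (rule Ck_on_cong)
  then show ?case using Suc.prems by (simp add: differentiable_on_add)
qed

text \<open>The derivative t f' + f is handled by induction for t f' and by the lower smoothness of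
  f for the rest. Hence the operator t d/dt costs just one derivative.\<close>

lemma Ck_on_ident_mult:
  fixes a b :: real
  assumes "a < b" "Ck_on k f {a..b}"
  shows "Ck_on k (\<lambda>t. t * f t) {a..b}"
  using assms(2)
proof (induction k arbitrary: f)
  case 0
  then show ?case by (auto intro!: continuous_intros)
next
  case (Suc k)
  let ?D = "\<lambda>t. vector_derivative f (at t within {a..b})"
  have D: "((\<lambda>t. t * f t) has_vector_derivative (t * ?D t + f t)) (at t within {a..b})"
    if "t \<in> {a..b}" for t
    using DERIV_mult[OF DERIV_ident, of f "?D t" t "{a..b}"] Ck_on_has_vector_derivative[OF Suc.prems that]
    by (simp add: has_real_derivative_iff_has_vector_derivative algebra_simps)
  then have "t * ?D t + f t = vector_derivative (\<lambda>t. t * f t) (at t within {a..b})"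
    if "t \<in> {a..b}" for t
    using vector_derivative_within_closed_interval[OF assms(1) that D[OF that]] by simp
  moreover have "Ck_on k (\<lambda>t. t * ?D t + f t) {a..b}"
    using Suc.prems Ck_on_Suc_imp[OF Suc.prems] by (intro Ck_on_add[OF assms(1)] Suc.IH) auto
  ultimately have "Ck_on k (\<lambda>t. vector_derivative (\<lambda>t. t * f t) (at t within {a..b})) {a..b}"
    by (rule Ck_on_cong)
  moreover have "(\<lambda>t. t * f t) differentiable_on {a..b}"
    unfolding differentiable_on_def using D differentiableI_vector by blast
  ultimately show ?case by simp
qed

lemma Ck_on_hd0:
  assumes "a < b" "Ck_on (k + i) x {a..b}"
  shows "Ck_on k (hd0 {a..b} x i) {a..b}"
  using assms(2)
proof (induction i arbitrary: k)
  case (Suc i)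
  have "Ck_on (Suc k) (hd0 {a..b} x i) {a..b}"
    using Suc.prems by (intro Suc.IH) (simp only: add_Suc add_Suc_right)
  then show ?case using Ck_on_ident_mult[OF assms(1)] by simp
qed simp

text \<open>The identity holds at every real s, so the two functions are equal and can be exchanged
  under \<open>vector_derivative\<close>. It makes x_{k,1} the derivative of x_{k,0}.\<close>

lemma ident_mult_hd1: "s * hd1 S x k s = hd0 S x (Suc k) s"
proof (induction k arbitrary: s)
  case (Suc k)
  have "(\<lambda>s. s * hd1 S x k s) = hd0 S x (Suc k)"
    using Suc.IH by (intro ext)
  then show ?case
    unfolding hd1.simps(2) hd0.simps(2)[of S x "Suc k"] by (simp only:)
qed simp

lemma hd1_eq: "hd1 S x k t = vector_derivative (hd0 S x k) (at t within S)"
  by (cases k) (simp_all only: hd1.simps ident_mult_hd1 hd0.simps(1))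

subsection \<open>The truncation error\<close>

lemma V_has_integral:
  assumes "0 < a" "a < t" "continuous_on {a..t} x"
  shows "((\<lambda>\<tau>. real (Suc m) * ln (\<tau> / a) ^ m * (x \<tau> / \<tau>)) has_integral V n a x (n + 1 + m) t) {a..t}"
proof -
  let ?f = "\<lambda>\<tau>. real (Suc m) * ln (\<tau> / a) ^ m * (x \<tau> / \<tau>)"
  have c: "continuous_on {a..t} ?f"
    using assms by (auto intro!: continuous_intros)
  then have "set_integrable lborel {a..t} ?f"
    by (rule borel_integrable_atLeastAtMost')
  then have "V n a x (n + 1 + m) t = integral {a..t} ?f"
    using assms interval_integral_eq_integral[of a t ?f] by (simp add: V_def)
  with integrable_integral[OF integrable_continuous_interval[OF c]] show ?thesis by simp
qed

text \<open>For \<alpha> < 1 the weight is singular at t, but it is nonnegative with the continuous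
  antiderivative -ln(t/\<tau>)^\<alpha>/\<alpha>, hence absolutely integrable. Multiplication by the
  bounded measurable x preserves this.\<close>

lemma hadamard_integrand_has_integral:
  assumes "0 < a" "a < t" "\<alpha> > 0" "continuous_on {a..t} x"
  shows "((\<lambda>\<tau>. ln (t / \<tau>) powr (\<alpha> - 1) * (x \<tau> / \<tau>)) has_integral
           Gamma \<alpha> * hadamard_integral a \<alpha> x t) {a..t}"
proof -
  let ?w = "\<lambda>\<tau>. ln (t / \<tau>) powr (\<alpha> - 1) / \<tau>"
  let ?f = "\<lambda>\<tau>. ln (t / \<tau>) powr (\<alpha> - 1) * (x \<tau> / \<tau>)"
  have c: "continuous_on {a..t} (\<lambda>\<tau>. - (ln (t / \<tau>) powr \<alpha> / \<alpha>))"
    using assms(1-3) by (intro continuous_on_minus continuous_on_divide continuous_on_powr' continuous_on_const)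
      (auto intro!: continuous_intros)
  have "((\<lambda>\<tau>. - (ln (t / \<tau>) powr \<alpha> / \<alpha>)) has_vector_derivative ?w \<tau>) (at \<tau>)"
    if "\<tau> \<in> {a<..<t}" for \<tau>
  proof -
    have "ln (t / \<tau>) > 0" using that assms by (auto simp: ln_gt_zero)
    then have "((\<lambda>\<tau>. - (ln (t / \<tau>) powr \<alpha> / \<alpha>)) has_real_derivative ?w \<tau>) (at \<tau>)"
      using assms(1-3) that by (auto intro!: derivative_eq_intros simp: field_simps powr_diff)
    then show ?thesis by (simp add: has_real_derivative_iff_has_vector_derivative)
  qed
  from fundamental_theorem_of_calculus_interior[OF _ c this] assms(2)
  have "?w integrable_on {a..t}" by (auto simp: integrable_on_def)
  then have "?w absolutely_integrable_on {a..t}"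
    by (rule nonnegative_absolutely_integrable_1) (use assms in auto)
  then have "(\<lambda>\<tau>. x \<tau> * ?w \<tau>) absolutely_integrable_on {a..t}"
    using assms(4)
    by (intro absolutely_integrable_bounded_measurable_product_real
        continuous_imp_measurable_on_sets_lebesgue compact_imp_bounded compact_continuous_image) auto
  then have ai: "?f absolutely_integrable_on {a..t}" by (simp add: mult_ac)
  \<comment> \<open>The integral in the definition is over \<open>lborel\<close>, so Borel
    measurability is required; cutting x off outside the interval provides it, as x is continuous
    only there.\<close>
  have "(\<lambda>\<tau>. indicator {a..t} \<tau> *\<^sub>R x \<tau>) \<in> borel_measurable borel"
    using assms(4) by (intro borel_measurable_continuous_on_indicator) auto
  then have "(\<lambda>\<tau>. ln (t / \<tau>) powr (\<alpha> - 1) * ((indicator {a..t} \<tau> *\<^sub>R x \<tau>) / \<tau>)) \<in> borel_measurable lborel"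
    by measurable
  then have "(\<lambda>\<tau>. indicator {a..t} \<tau> *\<^sub>R ?f \<tau>) \<in> borel_measurable lborel"
    by (simp add: mult_ac)
  with ai have si: "set_integrable lborel {a..t} ?f"
    unfolding set_integrable_def using integrable_completion by blast
  then have "(LBINT \<tau>=a..t. ?f \<tau>) = integral {a..t} ?f"
    using assms by (intro interval_integral_eq_integral) auto
  moreover have "Gamma \<alpha> > 0" using assms by simp
  ultimately have "Gamma \<alpha> * hadamard_integral a \<alpha> x t = integral {a..t} ?f"
    by (simp add: hadamard_integral_def)
  then show ?thesis
    using set_lebesgue_integral_eq_integral(1)[OF ai] by (simp add: integrable_integral)
qed

text \<open>Termwise integration of the kernel at \<gamma> = \<alpha> - 1, where Gamma(\<gamma>+1) =
  Gamma(\<alpha>) and -\<gamma> = 1 - \<alpha>; degree m corresponds to p = n + 1 + m.\<close>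

lemma hadamard_kernel_base_has_integral:
  assumes "0 < a" "a < t" "\<alpha> > 0" "continuous_on {a..t} x"
  shows "((\<lambda>\<tau>. hadamard_kernel a t (\<alpha> - 1) M \<tau> * (x \<tau> / \<tau>)) has_integral
           hadamard_integral a \<alpha> x t - (\<Sum>m\<le>M. BV_term n \<alpha> a x t (n + 1 + m))) {a..t}"
proof -
  define k where "k m = pochhammer (1 - \<alpha>) m / fact m * ln (t / a) powr (\<alpha> - 1 - real m)" for m
  have G: "Gamma \<alpha> > 0" using assms by simp
  \<comment> \<open>B has (p-n)! = (m+1)! where the kernel has m!; the extra m + 1 is compensated by
    the factor p - n inside V_p.\<close>
  have BV: "BV_term n \<alpha> a x t (n + 1 + m) = k m / real (Suc m) * V n a x (n + 1 + m) t / Gamma \<alpha>" for m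
  proof -
    have "\<alpha> + real n - real (n + 1 + m) = \<alpha> - 1 - real m" by simp
    then show ?thesis
      by (simp only: BV_term_def) (simp add: B_coeff_def Gamma_quot_eq_pochhammer k_def)
  qed
  have "((\<lambda>\<tau>. (ln (t / \<tau>) powr (\<alpha> - 1) * (x \<tau> / \<tau>)
       - (\<Sum>m\<le>M. k m / real (Suc m) * (real (Suc m) * ln (\<tau> / a) ^ m * (x \<tau> / \<tau>)))) / Gamma \<alpha>)
     has_integral (Gamma \<alpha> * hadamard_integral a \<alpha> x t
       - (\<Sum>m\<le>M. k m / real (Suc m) * V n a x (n + 1 + m) t)) / Gamma \<alpha>) {a..t}"
    using assms by (intro has_integral_divide has_integral_diff has_integral_sum
        has_integral_mult_right hadamard_integrand_has_integral V_has_integral) auto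
  also have "(Gamma \<alpha> * hadamard_integral a \<alpha> x t
       - (\<Sum>m\<le>M. k m / real (Suc m) * V n a x (n + 1 + m) t)) / Gamma \<alpha>
     = hadamard_integral a \<alpha> x t - (\<Sum>m\<le>M. BV_term n \<alpha> a x t (n + 1 + m))"
    using G unfolding BV by (simp add: diff_divide_distrib sum_divide_distrib)
  also have "(\<lambda>\<tau>. (ln (t / \<tau>) powr (\<alpha> - 1) * (x \<tau> / \<tau>)
       - (\<Sum>m\<le>M. k m / real (Suc m) * (real (Suc m) * ln (\<tau> / a) ^ m * (x \<tau> / \<tau>)))) / Gamma \<alpha>)
     = (\<lambda>\<tau>. hadamard_kernel a t (\<alpha> - 1) M \<tau> * (x \<tau> / \<tau>))"
  proof
    fix \<tau>
    have "(\<Sum>m\<le>M. k m / real (Suc m) * (real (Suc m) * ln (\<tau> / a) ^ m * (x \<tau> / \<tau>)))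
       = (\<Sum>m\<le>M. k m * ln (\<tau> / a) ^ m) * (x \<tau> / \<tau>)"
      unfolding sum_distrib_right by (intro sum.cong refl) (simp del: of_nat_Suc)
    moreover have "hadamard_kernel a t (\<alpha> - 1) M \<tau>
       = (ln (t / \<tau>) powr (\<alpha> - 1) - (\<Sum>m\<le>M. k m * ln (\<tau> / a) ^ m)) / Gamma \<alpha>"
      by (simp add: hadamard_kernel_def k_def)
    ultimately show "(ln (t / \<tau>) powr (\<alpha> - 1) * (x \<tau> / \<tau>)
       - (\<Sum>m\<le>M. k m / real (Suc m) * (real (Suc m) * ln (\<tau> / a) ^ m * (x \<tau> / \<tau>)))) / Gamma \<alpha>
      = hadamard_kernel a t (\<alpha> - 1) M \<tau> * (x \<tau> / \<tau>)"
      by (simp only: left_diff_distrib times_divide_eq_left)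
  qed
  finally show ?thesis .
qed

text \<open>One integral, that of the kernel with exponent \<alpha> - 1 and degree M against
  x(\<tau>)/\<tau>, is evaluated termwise and by n + 1 integrations by parts. Uniqueness of the
  integral identifies E.\<close>

lemma truncation_error_has_integral:
  assumes "0 < a" "a < b" "\<alpha> > 0" "Ck_on (n + 1) x {a..b}" "t \<in> {a<..<b}"
  shows "((\<lambda>\<tau>. hadamard_kernel a t (\<alpha> + real n) (Suc (M + n)) \<tau> * hd1 {a..b} x n \<tau>)
           has_integral truncation_error n (Suc (M + n)) \<alpha> a b x t) {a..t}"
proof -
  let ?y = "hd0 {a..b} x" and ?d = "hd1 {a..b} x"
  let ?K = "hadamard_kernel a t (\<alpha> + real n) (Suc (M + n))"
  have sub: "{a..t} \<subseteq> {a..b}" and t: "a < t" using assms(5) by auto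
  have y: "(?y i has_real_derivative ?d i \<tau>) (at \<tau> within {a..t})"
    if "i \<le> n" "\<tau> \<in> {a..t}" for i \<tau>
  proof -
    have "Ck_on (Suc (n - i)) (?y i) {a..b}"
      using assms(4) that(1) by (intro Ck_on_hd0[OF assms(2)]) simp
    from Ck_on_has_vector_derivative[OF this, of \<tau>] sub that(2)
    have "(?y i has_vector_derivative ?d i \<tau>) (at \<tau> within {a..b})" by (auto simp: hd1_eq)
    from has_vector_derivative_within_subset[OF this sub]
    show ?thesis by (simp add: has_real_derivative_iff_has_vector_derivative)
  qed
  \<comment> \<open>One derivative is left after n steps, so x_{n,1} is continuous. As \<alpha> + n
    > 0, the kernel is continuous up to t, which gives the existence of E.\<close>
  have "Ck_on 1 (?y n) {a..b}"
    using assms(4) by (intro Ck_on_hd0[OF assms(2)]) simp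
  then have "continuous_on {a..b} (?d n)" by (simp add: hd1_eq[abs_def])
  then have "continuous_on {a..t} (\<lambda>\<tau>. ?K \<tau> * ?d n \<tau>)"
    using assms t by (intro continuous_on_mult hadamard_kernel_continuous)
      (auto intro: continuous_on_subset[OF _ sub])
  then obtain E where E: "((\<lambda>\<tau>. ?K \<tau> * ?d n \<tau>) has_integral E) {a..t}"
    using integrable_continuous_interval by blast
  have "continuous_on {a..t} x"
    using DERIV_continuous_on[OF y[of 0]] by simp
  note base = hadamard_kernel_base_has_integral[OF assms(1) t assms(3) this, of M n]
  have "((\<lambda>\<tau>. hadamard_kernel a t (\<alpha> - 1) M \<tau> * (?y 0 \<tau> / \<tau>)) has_integral
      (E - (\<Sum>i\<le>n. hadamard_kernel a t (\<alpha> + real i) (Suc (M + i)) t * ?y i t))) {a..t}"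
    by (rule hadamard_kernel_iterated_by_parts[where d = ?d])
      (use assms t y E in \<open>auto simp: ident_mult_hd1\<close>)
  with base have "E - (\<Sum>i\<le>n. hadamard_kernel a t (\<alpha> + real i) (Suc (M + i)) t * ?y i t)
      = hadamard_integral a \<alpha> x t - (\<Sum>m\<le>M. BV_term n \<alpha> a x t (n + 1 + m))"
    by (auto intro: has_integral_unique)
  moreover have "(\<Sum>i\<le>n. hadamard_kernel a t (\<alpha> + real i) (Suc (M + i)) t * ?y i t)
      = - (\<Sum>i = 0..n. A_coeff_trunc n \<alpha> (Suc (M + n)) i * ln (t / a) powr (\<alpha> + real i) * ?y i t)"
    unfolding sum_negf[symmetric] atLeast0AtMost
    by (intro sum.cong refl) (simp add: hadamard_kernel_right[OF assms(1) t] A_coeff_trunc_eq mult_ac)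
  moreover have "(\<Sum>m\<le>M. BV_term n \<alpha> a x t (n + 1 + m)) = (\<Sum>p = n + 1..Suc (M + n). BV_term n \<alpha> a x t p)"
    using sum.shift_bounds_cl_nat_ivl[of "BV_term n \<alpha> a x t" 0 "n + 1" M]
    by (simp add: atLeast0AtMost add.commute)
  ultimately have "E = truncation_error n (Suc (M + n)) \<alpha> a b x t"
    by (simp add: truncation_error_def hadamard_approx_def)
  with E show ?thesis by simp
qed

section \<open>Error bound and passage to the limit\<close>

text \<open>The uniform kernel bound at \<beta> = \<alpha> + n, the maximum of |x_{n,1}| and the
  length t - a of the interval are multiplied.\<close>

lemma abs_truncation_error_le:
  assumes "0 < a" "a < b" "\<alpha> > 0" "Ck_on (n + 1) x {a..b}" "t \<in> {a<..<b}"
    and "N \<ge> n + 1"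
  shows "\<bar>truncation_error n N \<alpha> a b x t\<bar>
            \<le> L_max n a b x t
              * (exp ((\<alpha> + real n)\<^sup>2 + \<alpha> + real n)
                 / (Gamma (\<alpha> + real n + 1) * (\<alpha> + real n) * real N powr (\<alpha> + real n)))
              * ln (t / a) powr (\<alpha> + real n) * (t - a)"
proof -
  define M where "M = N - n - 1"
  have N: "N = Suc (M + n)" using assms(6) by (simp add: M_def)
  define C where "C = exp ((\<alpha> + real n)\<^sup>2 + \<alpha> + real n)
                 / (Gamma (\<alpha> + real n + 1) * (\<alpha> + real n) * real N powr (\<alpha> + real n))
              * ln (t / a) powr (\<alpha> + real n)"
  have t: "a < t" and sub: "{a..t} \<subseteq> {a..b}" using assms(5) by auto
  have C0: "C \<ge> 0" unfolding C_def using assms(3) Gamma_real_pos[of "\<alpha> + real n + 1"]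
    by (intro mult_nonneg_nonneg divide_nonneg_nonneg) auto
  have "Ck_on 1 (hd0 {a..b} x n) {a..b}"
    using assms(4) by (intro Ck_on_hd0[OF assms(2)]) simp
  then have "continuous_on {a..b} (hd1 {a..b} x n)" by (simp add: hd1_eq[abs_def])
  then have "continuous_on {a..t} (\<lambda>\<tau>. \<bar>hd1 {a..b} x n \<tau>\<bar>)"
    by (intro continuous_on_rabs continuous_on_subset[OF _ sub])
  then have "bdd_above ((\<lambda>\<tau>. \<bar>hd1 {a..b} x n \<tau>\<bar>) ` {a..t})"
    by (intro bounded_imp_bdd_above compact_imp_bounded compact_continuous_image) auto
  then have L: "\<bar>hd1 {a..b} x n \<tau>\<bar> \<le> L_max n a b x t" if "\<tau> \<in> {a..t}" for \<tau>
    unfolding L_max_def using that by (rule cSUP_upper2) auto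
  then have L0: "L_max n a b x t \<ge> 0" using order_trans[OF abs_ge_zero L[of a]] t by simp
  have "norm (truncation_error n N \<alpha> a b x t) \<le> (C * L_max n a b x t) * measure lborel (cbox a t)"
  \<comment> \<open>The kernel bound is available only for \<tau> < t; the single point t does not
    affect the integral.\<close>
  proof (rule has_integral_bound_spike_finite)
    show "((\<lambda>\<tau>. hadamard_kernel a t (\<alpha> + real n) N \<tau> * hd1 {a..b} x n \<tau>)
        has_integral truncation_error n N \<alpha> a b x t) (cbox a t)"
      unfolding N box_real(2) by (rule truncation_error_has_integral[OF assms(1-5)])
    show "norm (hadamard_kernel a t (\<alpha> + real n) N \<tau> * hd1 {a..b} x n \<tau>) \<le> C * L_max n a b x t"
      if "\<tau> \<in> cbox a t - {t}" for \<tau>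
      unfolding real_norm_def abs_mult
    proof (rule mult_mono)
      show "\<bar>hadamard_kernel a t (\<alpha> + real n) N \<tau>\<bar> \<le> C"
        using abs_hadamard_kernel_le[of a \<tau> t "\<alpha> + real n" N] that assms N
        by (auto simp: C_def add.assoc)
    qed (use that L C0 in auto)
  qed (use C0 L0 in auto)
  then show ?thesis using t by (simp add: C_def mult_ac)
qed

lemma truncation_error_tendsto_0:
  assumes "0 < a" "a < b" "\<alpha> > 0" "Ck_on (n + 1) x {a..b}" "t \<in> {a<..<b}"
  shows "(\<lambda>M. truncation_error n (Suc (M + n)) \<alpha> a b x t) \<longlonglongrightarrow> 0"
proof (rule Lim_null_comparison)
  define C where "C = L_max n a b x t
              * (exp ((\<alpha> + real n)\<^sup>2 + \<alpha> + real n) / (Gamma (\<alpha> + real n + 1) * (\<alpha> + real n)))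
              * ln (t / a) powr (\<alpha> + real n) * (t - a)"
  show "\<forall>\<^sub>F M in sequentially. norm (truncation_error n (Suc (M + n)) \<alpha> a b x t)
      \<le> C * real (M + Suc n) powr (- (\<alpha> + real n))"
  proof (intro always_eventually allI)
    fix M
    show "norm (truncation_error n (Suc (M + n)) \<alpha> a b x t) \<le> C * real (M + Suc n) powr (- (\<alpha> + real n))"
      using abs_truncation_error_le[OF assms, of "Suc (M + n)"]
      unfolding powr_minus_divide C_def by simp
  qed
  have "(\<lambda>N. real N powr (- (\<alpha> + real n))) \<longlonglongrightarrow> 0"
    using assms(3) by (intro tendsto_neg_powr filterlim_real_sequentially) auto
  then show "(\<lambda>M. C * real (M + Suc n) powr (- (\<alpha> + real n))) \<longlonglongrightarrow> 0"
    by (intro tendsto_mult_right_zero LIMSEQ_ignore_initial_segment)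
qed

theorem theorem3p2:
  fixes \<alpha> a b :: real and n :: nat and x :: "real \<Rightarrow> real"
  assumes "\<alpha> > 0" and "n \<ge> 1" and "0 < a" and "a < b"
    and "Ck_on (n + 1) x {a..b}"
  shows
    "(\<forall>i\<le>n. summable (\<lambda>k. A_term n \<alpha> i (n - i + 1 + k)))
     \<and> (\<forall>t\<in>{a<..<b}.
          summable (\<lambda>k. BV_term n \<alpha> a x t (n + 1 + k))
          \<and> hadamard_integral a \<alpha> x t
             = (\<Sum>i = 0..n. A_coeff n \<alpha> i * ln (t / a) powr (\<alpha> + real i) * hd0 {a..b} x i t)
               + (\<Sum>k. BV_term n \<alpha> a x t (n + 1 + k)))
     \<and> (\<forall>N\<ge>n + 1. \<forall>t\<in>{a<..<b}.
          \<bar>truncation_error n N \<alpha> a b x t\<bar>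
            \<le> L_max n a b x t
              * (exp ((\<alpha> + real n)\<^sup>2 + \<alpha> + real n)
                 / (Gamma (\<alpha> + real n + 1) * (\<alpha> + real n) * real N powr (\<alpha> + real n)))
              * ln (t / a) powr (\<alpha> + real n) * (t - a))"
proof (intro conjI allI impI ballI)
  show "summable (\<lambda>k. A_term n \<alpha> i (n - i + 1 + k))" if "i \<le> n" for i
    using summable_A_term assms(1) that .
next
  fix t assume t: "t \<in> {a<..<b}"
  let ?A = "\<lambda>c. \<Sum>i = 0..n. c i * ln (t / a) powr (\<alpha> + real i) * hd0 {a..b} x i t"
  let ?B = "\<lambda>m. BV_term n \<alpha> a x t (n + 1 + m)"
  \<comment> \<open>The partial sums of the V_p series are expressed through the integral, the
    truncated A-sum and the error. All of these converge, so summability and value come together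
    without any estimate of V_p.\<close>
  have "(\<lambda>M. hadamard_integral a \<alpha> x t - ?A (A_coeff_trunc n \<alpha> (Suc (M + n)))
      - truncation_error n (Suc (M + n)) \<alpha> a b x t)
    \<longlonglongrightarrow> hadamard_integral a \<alpha> x t - ?A (A_coeff n \<alpha>) - 0"
    using assms t
    by (intro tendsto_diff tendsto_const tendsto_sum tendsto_mult_right
        A_coeff_trunc_tendsto truncation_error_tendsto_0) auto
  also have "(\<lambda>M. hadamard_integral a \<alpha> x t - ?A (A_coeff_trunc n \<alpha> (Suc (M + n)))
      - truncation_error n (Suc (M + n)) \<alpha> a b x t) = (\<lambda>M. sum ?B {..M})"
  proof
    fix M
    show "hadamard_integral a \<alpha> x t - ?A (A_coeff_trunc n \<alpha> (Suc (M + n)))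
      - truncation_error n (Suc (M + n)) \<alpha> a b x t = sum ?B {..M}"
      using sum.shift_bounds_cl_nat_ivl[of "BV_term n \<alpha> a x t" 0 "n + 1" M]
      by (simp add: truncation_error_def hadamard_approx_def atLeast0AtMost add.commute)
  qed
  finally have "?B sums (hadamard_integral a \<alpha> x t - ?A (A_coeff n \<alpha>))"
    by (simp add: sums_def_le)
  then show "summable ?B" "hadamard_integral a \<alpha> x t = ?A (A_coeff n \<alpha>) + (\<Sum>k. ?B k)"
    by (auto simp: sums_iff)
next
  fix N t assume "N \<ge> n + 1" "t \<in> {a<..<b}"
  then show "\<bar>truncation_error n N \<alpha> a b x t\<bar>
            \<le> L_max n a b x t
              * (exp ((\<alpha> + real n)\<^sup>2 + \<alpha> + real n)
                 / (Gamma (\<alpha> + real n + 1) * (\<alpha> + real n) * real N powr (\<alpha> + real n)))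
              * ln (t / a) powr (\<alpha> + real n) * (t - a)"
    using abs_truncation_error_le assms by blast
qed

end
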